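(* If $n-d=2$, then the Gr\"obner fan of $I_{\mathcal C_{\mathcal A}}$ is a refinement of the Gr\"obner fan of $I_{\mathcal A}$.
   Context: Setting: $\mathcal A=\{\mathbf a_1,\dots,\mathbf a_n\}\subset\mathbb{Z}^d$ is an ordered vector configuration such that the $d\times n$ matrix $A=[\mathbf a_1\cdots\mathbf a_n]$ has rank $d$; $\mathcal L_{\mathcal A}=\{\mathbf u\in\mathbb{Z}^n: A\mathbf u=\mathbf 0\}$, and it is assumed that $\mathcal L_{\mathcal A}\cap\mathbb{N}^n=\{\mathbf 0\}$ ($\mathbb N$ contains $0$). $\mathbf k$ is an algebraically closed field, $\mathbf k[\mathbf x]=\mathbf k[x_1,\dots,x_n]$. For $\mathbf u\in\mathbb{Z}^n$: $\mathrm{supp}(\mathbf u)=\{i:u_i\ne0\}$, $\mathbf u^+_i=\max(u_i,0)$, $\mathbf u^-_i=\max(-u_i,0)$. Circuit: a non-zero vector $\mathbf c\in\mathcal L_{\mathcal A}$ whose entries have greatest common divisor one and such that no non-zero $\mathbf d\in\mathcal L_{\mathcal A}$ has $\mathrm{supp}(\mathbf d)\subsetneq\mathrm{supp}(\mathbf c)$. Circuit ideal: $I_{\mathcal C_{\mathcal A}}=\langle\mathbf x^{\mathbf c^+}-\mathbf x^{\mathbf c^-}:\mathbf c\text{ a circuit}\rangle$. Toric ideal: $I_{\mathcal A}=\langle\mathbf x^{\mathbf u^+}-\mathbf x^{\mathbf u^-}:\mathbf u\in\mathcal L_{\mathcal A}\rangle$. Initial ideals: for $\omega\in\mathbb{R}^n$,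 $\mathrm{in}_\omega(f)$ is the sum of the terms $c\,\mathbf x^{\mathbf u}$ of $f$ with $\omega\cdot\mathbf u$ maximal, and $\mathrm{in}_\omega(I)=\langle\mathrm{in}_\omega(f):f\in I\rangle$. Gr\"obner fan: for an ideal $I$ homogeneous with respect to a strictly positive integer grading vector, the Gr\"obner fan of $I$ is the polyhedral fan in $\mathbb{R}^n$ whose cones are the closures of the equivalence classes of the relation $\mathbf u\sim\mathbf v\Leftrightarrow\mathrm{in}_{\mathbf u}(I)=\mathrm{in}_{\mathbf v}(I)$. A fan $F$ is a refinement of a fan $G$ (with the same support) if every cone of $F$ is contained in a cone of $G$. *)

theory Defs
  imports
    "HOL-Analysis.Analysis"
    "HOL-Computational_Algebra.Polynomial"
    "HOL-Library.Poly_Mapping"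
begin

text \<open>The polynomial ring over \<open>'k\<close> in variables indexed by \<open>'n\<close>, as the monoid algebra of
  \<open>\<nat>\<^sup>n\<close>: a polynomial maps each exponent vector to its coefficient, and multiplication on
  \<open>\<Rightarrow>\<^sub>0\<close> is convolution.\<close>

type_synonym ('n, 'k) mpoly = "(nat, 'n) vec \<Rightarrow>\<^sub>0 'k"

text \<open>The ideals of a commutative ring are its submodules as a module over itself.\<close>

lemma module_times: "module ((*) :: 'a::comm_ring_1 \<Rightarrow> 'a \<Rightarrow> 'a)"
  by unfold_locales (simp_all add: algebra_simps)

definition ideal_gen :: "'a::comm_ring_1 set \<Rightarrow> 'a set" where
  "ideal_gen B = module.span (*) B"

text \<open>The columns of \<open>A\<close> are the vectors of the configuration; they need not be distinct.\<close>

definition lattice_of :: "int^'n^'d \<Rightarrow> (int^'n) set" where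
  "lattice_of A = {u. A *v u = 0}"

definition vsupp :: "int^'n \<Rightarrow> 'n set" where
  "vsupp u = {i. u $ i \<noteq> 0}"

definition pos_part :: "int^'n \<Rightarrow> nat^'n" where
  "pos_part u = (\<chi> i. nat (max (u $ i) 0))"

definition neg_part :: "int^'n \<Rightarrow> nat^'n" where
  "neg_part u = (\<chi> i. nat (max (- u $ i) 0))"

definition circuit :: "int^'n^'d \<Rightarrow> int^'n \<Rightarrow> bool" where
  "circuit A c \<longleftrightarrow> c \<in> lattice_of A \<and> c \<noteq> 0 \<and> Gcd (range (\<lambda>i. c $ i)) = 1 \<and>
     \<not> (\<exists>d\<in>lattice_of A. d \<noteq> 0 \<and> vsupp d \<subset> vsupp c)"

definition monomial_of :: "nat^'n \<Rightarrow> ('n, 'k::comm_ring_1) mpoly" where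
  "monomial_of e = Poly_Mapping.single e 1"

definition binomial_of :: "int^'n \<Rightarrow> ('n, 'k::comm_ring_1) mpoly" where
  "binomial_of u = monomial_of (pos_part u) - monomial_of (neg_part u)"

definition circuit_ideal :: "int^'n^'d \<Rightarrow> ('n, 'k::comm_ring_1) mpoly set" where
  "circuit_ideal A = ideal_gen (binomial_of ` {c. circuit A c})"

definition toric_ideal :: "int^'n^'d \<Rightarrow> ('n, 'k::comm_ring_1) mpoly set" where
  "toric_ideal A = ideal_gen (binomial_of ` lattice_of A)"

definition weight :: "real^'n \<Rightarrow> nat^'n \<Rightarrow> real" where
  "weight w e = (\<Sum>i\<in>UNIV. w $ i * real (e $ i))"

definition initial_form :: "real^'n \<Rightarrow> ('n, 'k::comm_ring_1) mpoly \<Rightarrow> ('n, 'k) mpoly" where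
  "initial_form w f =
     (\<Sum>e\<in>{e \<in> Poly_Mapping.keys f. \<forall>e'\<in>Poly_Mapping.keys f. weight w e' \<le> weight w e}.
        Poly_Mapping.single e (Poly_Mapping.lookup f e))"

definition initial_ideal :: "real^'n \<Rightarrow> ('n, 'k::comm_ring_1) mpoly set \<Rightarrow> ('n, 'k) mpoly set" where
  "initial_ideal w I = ideal_gen (initial_form w ` I)"

text \<open>A fan is represented by its set of cones. The set below is in general a polyhedral fan only
  if \<open>I\<close> is homogeneous for some strictly positive integer grading. Toric and circuit ideals are
  homogeneous in this sense whenever the lattice meets the nonnegative orthant only in \<open>0\<close>:
  some strictly positive integer vector then lies in the row space of \<open>A\<close>.\<close>

definition groebner_fan :: "('n::finite, 'k::comm_ring_1) mpoly set \<Rightarrow> (real^'n) set set" where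
  "groebner_fan I = {closure {v. initial_ideal u I = initial_ideal v I} | u. True}"

definition fan_refines :: "'a set set \<Rightarrow> 'a set set \<Rightarrow> bool" where
  "fan_refines F G \<longleftrightarrow> \<Union>F = \<Union>G \<and> (\<forall>C\<in>F. \<exists>D\<in>G. C \<subseteq> D)"

end

theory Submission
  imports Defs "HOL-Computational_Algebra.Group_Closure"
begin

text \<open>Both ideals are generated by differences of monomials, so everything about them is encoded in
  the congruence \<open>e ~ e' \<longleftrightarrow> x\<^sup>e - x\<^sup>e' \<in> I\<close> on exponent vectors. For the toric ideal the classes of \<open>~\<close>
  are the fibres \<open>{e'. e - e' \<in> L}\<close> of the lattice \<open>L\<close> of \<open>A\<close>; for the circuit ideal they are the
  components of the graphs on the fibres whose edges are the circuits. The initial ideal for a weight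
  \<open>w\<close> records exactly which exponents have minimal weight in their class: \<open>x\<^sup>e\<close> lies in it if and only if
  \<open>e\<close> is not minimal, and two initial ideals agree as soon as their sets of minimal exponents do
  (\<open>initial_ideal_eq_iff_minimal\<close>). The claim therefore becomes combinatorial: if \<open>u\<close> and \<open>v\<close> have the
  same minimal points in every component, then they have the same minimal points in every fibre.

  Suppose that \<open>e\<close> is minimal in its fibre for \<open>u\<close> but not for \<open>v\<close>. Fibres are finite, so on the segment
  from \<open>u\<close> to \<open>v\<close> there is a last weight \<open>w\<close> for which \<open>e\<close> is minimal, and then some \<open>q \<in> L\<close> with
  \<open>e - q \<ge> 0\<close> satisfies \<open>w \<bullet> q = 0 < v \<bullet> q\<close>. Hence \<open>q\<^sup>+\<close> and \<open>q\<^sup>-\<close> are both of minimal weight for \<open>w\<close> in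
  their fibre, but circuits need not connect them. The key point (\<open>exists_minimal_join\<close>) is that they
  do so after a suitable translation that preserves minimality: there are \<open>a\<close> and \<open>a' = a - q\<close> in one
  component, both minimal for \<open>w\<close>. The common set of minimal points for \<open>u\<close> and \<open>v\<close> in that component
  is also the set of minimal points for \<open>w\<close>, so \<open>a\<close> and \<open>a'\<close> are minimal for \<open>v\<close>, which contradicts
  \<open>v \<bullet> q > 0\<close>.

  The translation exists because \<open>L\<close> has rank two. If \<open>w\<close> vanishes on \<open>L\<close>, then every point is minimal;
  if \<open>q\<close> is a multiple of a circuit, then \<open>q\<^sup>+\<close> and \<open>q\<^sup>-\<close> are connected already. Otherwise consider the
  polygon of nonnegative real points in the fibre of \<open>q\<^sup>+\<close>. Its points of smaller weight than \<open>q\<^sup>+\<close> form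
  a triangle over the segment from \<open>q\<^sup>+\<close> to \<open>q\<^sup>-\<close>, so just two coordinates \<open>i\<close> and \<open>j\<close> are responsible
  for the absence of lattice points there; all other coordinates of \<open>q\<^sup>+\<close> can be raised at will. With
  these raised, one can walk from the segment along the lines of the two sides, away from the apex,
  in the directions of the circuits that vanish at \<open>i\<close> and at \<open>j\<close>, as deep into the positive orthant
  as necessary (\<open>join_from_corner\<close>). Far inside, differences in \<open>L\<close> are connected because the
  circuits generate \<open>L\<close> as a group (\<open>joins_lattice\<close>).\<close>

section \<open>Initial ideals of binomial ideals\<close>

definition coeff_sum :: "(nat^'n::finite) set \<Rightarrow> ('n::finite, 'k::comm_ring_1) mpoly \<Rightarrow> 'k" where
  "coeff_sum S f = (\<Sum>e\<in>Poly_Mapping.keys f \<inter> S. Poly_Mapping.lookup f e)"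

lemma coeff_sum_superset:
  assumes "finite F" "Poly_Mapping.keys f \<subseteq> F"
  shows "coeff_sum S f = (\<Sum>e\<in>F \<inter> S. Poly_Mapping.lookup f e)"
  unfolding coeff_sum_def using assms
  by (intro sum.mono_neutral_left) (auto simp: in_keys_iff)

lemma coeff_sum_0 [simp]: "coeff_sum S 0 = 0"
  by (simp add: coeff_sum_def)

lemma coeff_sum_add: "coeff_sum S (f + g) = coeff_sum S f + coeff_sum S g"
proof -
  let ?F = "Poly_Mapping.keys f \<union> Poly_Mapping.keys g"
  have "finite ?F" by simp
  moreover have "Poly_Mapping.keys (f + g) \<subseteq> ?F" by (rule Poly_Mapping.keys_add)
  ultimately show ?thesis
    by (simp add: coeff_sum_superset[of ?F] lookup_add sum.distrib)
qed

lemma coeff_sum_uminus: "coeff_sum S (- f) = - coeff_sum S f"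
  by (simp add: coeff_sum_def sum_negf)

lemma coeff_sum_diff: "coeff_sum S (f - g) = coeff_sum S f - coeff_sum S g"
  using coeff_sum_add[of S f "- g"] by (simp add: coeff_sum_uminus)

lemma coeff_sum_sum: "coeff_sum S (\<Sum>x\<in>X. p x) = (\<Sum>x\<in>X. coeff_sum S (p x))"
  by (induction X rule: infinite_finite_induct) (simp_all add: coeff_sum_add)

lemma coeff_sum_single: "coeff_sum S (Poly_Mapping.single e a) = (if e \<in> S then a else 0)"
  by (auto simp: coeff_sum_def)

lemma poly_eq_sum_singles:
  "f = (\<Sum>e\<in>Poly_Mapping.keys f. Poly_Mapping.single e (Poly_Mapping.lookup f e))"
  by (rule poly_mapping_eqI)
     (simp add: lookup_sum lookup_single when_def in_keys_iff sum.delta cong: if_cong)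

text \<open>Coefficient sums over a set \<open>S\<close> are the linear functionals that detect non-membership: they see
  neither a monomial all of whose multiples avoid \<open>S\<close>, nor a difference of monomials whose common
  translates enter and leave \<open>S\<close> together.\<close>

lemma coeff_sum_eq_0_on_ideal:
  fixes f :: "('n::finite, 'k::comm_ring_1) mpoly"
  assumes f: "f \<in> ideal_gen G"
    and G: "\<And>b. b \<in> G \<Longrightarrow>
      (\<exists>e. b = monomial_of e \<and> (\<forall>g. g + e \<notin> S)) \<or>
      (\<exists>e e'. b = monomial_of e - monomial_of e' \<and> (\<forall>g. g + e \<in> S \<longleftrightarrow> g + e' \<in> S))"
  shows "coeff_sum S f = 0"
proof -
  interpret module "(*) :: ('n, 'k) mpoly \<Rightarrow> _" by (rule module_times)
  have "coeff_sum S (c * b) = 0" if "b \<in> G" for c b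
  proof -
    have "coeff_sum S (Poly_Mapping.single g a * b) = 0" for g a
      using G[OF that]
      by (auto simp: monomial_of_def mult_single right_diff_distrib coeff_sum_diff coeff_sum_single)
    then show ?thesis
      by (subst poly_eq_sum_singles[of c]) (simp add: sum_distrib_right coeff_sum_sum)
  qed
  with f show ?thesis
    unfolding ideal_gen_def
    by (induction rule: span_induct_alt) (simp_all add: coeff_sum_add)
qed

lemma ideal_gen_0: "0 \<in> ideal_gen G"
  unfolding ideal_gen_def by (rule module.span_zero[OF module_times])

lemma ideal_gen_base: "b \<in> G \<Longrightarrow> b \<in> ideal_gen G"
  unfolding ideal_gen_def by (rule module.span_base[OF module_times])

lemma ideal_gen_add: "f \<in> ideal_gen G \<Longrightarrow> g \<in> ideal_gen G \<Longrightarrow> f + g \<in> ideal_gen G"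
  unfolding ideal_gen_def by (rule module.span_add[OF module_times])

lemma ideal_gen_mult: "f \<in> ideal_gen G \<Longrightarrow> c * f \<in> ideal_gen G"
  unfolding ideal_gen_def by (rule module.span_scale[OF module_times])

lemma ideal_gen_sum: "(\<And>x. x \<in> X \<Longrightarrow> p x \<in> ideal_gen G) \<Longrightarrow> sum p X \<in> ideal_gen G"
  unfolding ideal_gen_def by (rule module.span_sum[OF module_times])

lemma ideal_gen_subset: "G \<subseteq> ideal_gen H \<Longrightarrow> ideal_gen G \<subseteq> ideal_gen H"
  unfolding ideal_gen_def
  by (metis module.span_minimal module.subspace_span module_times)

lemma single_eq_mult_monomial: "Poly_Mapping.single e a = Poly_Mapping.single 0 a * monomial_of e"
  by (simp add: monomial_of_def mult_single)

definition linked :: "('n::finite, 'k::comm_ring_1) mpoly set \<Rightarrow> nat^'n \<Rightarrow> nat^'n \<Rightarrow> bool" where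
  "linked I e e' \<longleftrightarrow> monomial_of e - monomial_of e' \<in> I"

text \<open>Initial forms collect the terms of maximal weight, so a monomial is an initial form of
  \<open>x\<^sup>e - x\<^sup>e'\<close> when the other exponent is smaller. This is why the exponents outside the initial ideal
  are those of least weight in their class.\<close>

definition minimal :: "(nat^'n \<Rightarrow> nat^'n \<Rightarrow> bool) \<Rightarrow> real^'n \<Rightarrow> nat^'n \<Rightarrow> bool" where
  "minimal R w e \<longleftrightarrow> (\<forall>e'. R e e' \<longrightarrow> weight w e \<le> weight w e')"

lemma monomial_of_add: "monomial_of (a + b) = monomial_of a * monomial_of b"
  by (simp add: monomial_of_def mult_single)

lemma weight_add: "weight w (a + b) = weight w a + weight w b"
  by (simp add: weight_def algebra_simps sum.distrib)

text \<open>These generators depend on \<open>w\<close> only through the set of minimal exponents; they turn out to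
  generate the initial ideal.\<close>

definition initial_gens :: "('n::finite, 'k::comm_ring_1) mpoly set \<Rightarrow> real^'n \<Rightarrow> ('n, 'k) mpoly set" where
  "initial_gens I w = {monomial_of e | e. \<not> minimal (linked I) w e} \<union>
     {monomial_of e - monomial_of e' | e e'. linked I e e' \<and> minimal (linked I) w e \<and> minimal (linked I) w e'}"

lemma keys_monomial_diff:
  assumes "e \<noteq> e'"
  shows "Poly_Mapping.keys (monomial_of e - monomial_of e' :: ('n::finite, 'k::comm_ring_1) mpoly) = {e, e'}"
proof -
  have "Poly_Mapping.lookup (monomial_of e - monomial_of e' :: ('n,'k) mpoly) k \<noteq> 0 \<longleftrightarrow> k = e \<or> k = e'" for k
    using assms by (auto simp: monomial_of_def lookup_minus lookup_single when_def)
  then show ?thesis by (auto simp: in_keys_iff)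
qed

lemma initial_form_monomial_diff:
  assumes "e \<noteq> e'"
  shows "initial_form w (monomial_of e - monomial_of e' :: ('n::finite, 'k::comm_ring_1) mpoly) =
    (if weight w e' < weight w e then monomial_of e
     else if weight w e < weight w e' then - monomial_of e'
     else monomial_of e - monomial_of e')"
proof -
  have T: "{k \<in> Poly_Mapping.keys (monomial_of e - monomial_of e' :: ('n,'k) mpoly).
      \<forall>e''\<in>Poly_Mapping.keys (monomial_of e - monomial_of e' :: ('n,'k) mpoly). weight w e'' \<le> weight w k}
    = (if weight w e' < weight w e then {e} else if weight w e < weight w e' then {e'} else {e, e'})"
    using assms by (auto simp: keys_monomial_diff)
  have l: "Poly_Mapping.lookup (monomial_of e - monomial_of e' :: ('n,'k) mpoly) e = 1"
     "Poly_Mapping.lookup (monomial_of e - monomial_of e' :: ('n,'k) mpoly) e' = -1"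
    using assms by (auto simp: monomial_of_def lookup_minus lookup_single when_def)
  show ?thesis
    unfolding initial_form_def T using assms
    by (auto simp: l) (simp_all add: monomial_of_def single_uminus)
qed

text \<open>The argument about initial ideals is the same for the toric ideal and for the circuit ideal.\<close>

locale binomial_ideal =
  fixes B :: "(int^'n) set" and I :: "('n::finite, 'k::comm_ring_1) mpoly set"
  assumes ideal_eq: "I = ideal_gen (binomial_of ` B)"
begin

lemma linked_refl: "linked I e e"
  by (simp add: linked_def ideal_eq ideal_gen_0)

lemma linked_sym:
  assumes "linked I e e'"
  shows "linked I e' e"
  using ideal_gen_mult[of _ _ "-1"] assms unfolding linked_def ideal_eq
  by fastforce

lemma linked_trans:
  assumes "linked I a b" "linked I b c"
  shows "linked I a c"
  using ideal_gen_add[OF assms[unfolded linked_def ideal_eq]]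
  unfolding linked_def ideal_eq by simp

lemma linked_translate:
  assumes "linked I a b"
  shows "linked I (g + a) (g + b)"
  using ideal_gen_mult[OF assms[unfolded linked_def ideal_eq], of "monomial_of g"]
  unfolding linked_def ideal_eq by (simp add: monomial_of_add right_diff_distrib)

lemma linked_pos_neg:
  assumes "u \<in> B"
  shows "linked I (pos_part u) (neg_part u)"
  using ideal_gen_base[of "binomial_of u" "binomial_of ` B"] assms
  unfolding linked_def ideal_eq binomial_of_def by blast

lemma coeff_sum_binomial_ideal:
  assumes "f \<in> I"
    and "\<And>u g. u \<in> B \<Longrightarrow> g + pos_part u \<in> S \<longleftrightarrow> g + neg_part u \<in> S"
  shows "coeff_sum S f = 0"
  using assms(1) unfolding ideal_eq
  by (rule coeff_sum_eq_0_on_ideal) (use assms(2) in \<open>unfold binomial_of_def, blast\<close>)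

lemma coeff_sum_class:
  fixes f :: "('n::finite, 'k::comm_ring_1) mpoly"
  assumes "f \<in> I"
  shows "coeff_sum {e'. linked I e e'} f = 0"
  using assms
proof (rule coeff_sum_binomial_ideal)
  fix u :: "int^'n" and g assume "u \<in> B"
  then have "linked I (g + pos_part u) (g + neg_part u)"
    by (intro linked_translate linked_pos_neg)
  then show "g + pos_part u \<in> {e'. linked I e e'} \<longleftrightarrow>
      g + neg_part u \<in> {e'. linked I e e'}"
    using linked_trans linked_sym by blast
qed

lemma minimal_weight_eq:
  "linked I e e' \<Longrightarrow> minimal (linked I) w e \<Longrightarrow>
   minimal (linked I) w e' \<Longrightarrow> weight w e = weight w e'"
  unfolding minimal_def using linked_sym by (meson order.antisym)

lemma initial_gens_subset:
  "initial_gens I w \<subseteq> initial_ideal w I"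
proof
  have in_ini: "initial_form w (monomial_of e - monomial_of e') \<in> initial_ideal w I"
    if "linked I e e'" for e e'
    using that unfolding initial_ideal_def linked_def by (auto intro: ideal_gen_base)
  fix b assume "b \<in> initial_gens I w"
  then consider e where "b = monomial_of e" "\<not> minimal (linked I) w e"
    | e e' where "b = monomial_of e - monomial_of e'" "linked I e e'" "minimal (linked I) w e" "minimal (linked I) w e'"
    unfolding initial_gens_def by blast
  then show "b \<in> initial_ideal w I"
  proof cases
    case 1
    then obtain e' where "linked I e e'" "weight w e' < weight w e"
      by (auto simp: minimal_def not_le)
    then show ?thesis
      using in_ini[of e e'] initial_form_monomial_diff[of e e' w, where ?'k = 'k] 1
      by (cases "e = e'") auto
  next
    case 2
    then have "weight w e = weight w e'" using minimal_weight_eq by blast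
    then show ?thesis
      using in_ini[OF 2(2)] initial_form_monomial_diff[of e e' w, where ?'k = 'k] 2
      by (cases "e = e'") (auto simp: initial_ideal_def ideal_gen_0)
  qed
qed

text \<open>Terms of the initial form at non-minimal exponents are generators up to a constant. At minimal
  exponents, replace each monomial by that of one representative of its class; the cost is a
  combination of the binomial generators. What remains vanishes: if the initial form has a minimal
  exponent in some class, then the terms of \<open>f\<close> in that class have both maximal weight in \<open>f\<close> and
  minimal weight in the class, so all of them belong to the initial form, and their coefficients sum
  to zero because \<open>f\<close> is in the ideal.\<close>

lemma initial_form_in_initial_gens:
  fixes f :: "('n::finite, 'k::comm_ring_1) mpoly"
  assumes f: "f \<in> I"
  shows "initial_form w f \<in> ideal_gen (initial_gens I w)"
proof -
  let ?J = "ideal_gen (initial_gens I w)"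
  define T where "T = {e \<in> Poly_Mapping.keys f. \<forall>e'\<in>Poly_Mapping.keys f. weight w e' \<le> weight w e}"
  define M where "M = {e \<in> T. minimal (linked I) w e}"
  define r where "r e = (SOME e'. linked I e e' \<and> minimal (linked I) w e')" for e
  have fin: "finite T" "finite M" by (auto simp: T_def M_def)
  have r: "linked I e (r e)" "minimal (linked I) w (r e)" if "minimal (linked I) w e" for e
    using someI[of "\<lambda>e'. linked I e e' \<and> minimal (linked I) w e'" e] that linked_refl
    unfolding r_def by blast+
  have r_eq: "r e = r e'" if "linked I e e'" for e e'
  proof -
    have "(\<lambda>x. linked I e x \<and> minimal (linked I) w x) = (\<lambda>x. linked I e' x \<and> minimal (linked I) w x)"
      using that linked_trans linked_sym by blast
    then show ?thesis by (simp add: r_def)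
  qed
  \<comment> \<open>The terms of \<open>f\<close> in a class that meets \<open>M\<close> are squeezed between the maximum over \<open>f\<close> and the
      minimum over the class.\<close>
  have class_keys: "Poly_Mapping.keys f \<inter> {e. linked I \<rho> e} = {e \<in> M. r e = \<rho>}" if \<rho>_in: "\<rho> \<in> r ` M" for \<rho>
  proof -
    obtain e0 where e0: "e0 \<in> M" "r e0 = \<rho>" using \<rho>_in by blast
    have c0: "linked I e0 \<rho>" using r e0 by (auto simp: M_def)
    have "k \<in> M \<and> r k = \<rho>" if k: "k \<in> Poly_Mapping.keys f" "linked I \<rho> k" for k
    proof -
      have c: "linked I e0 k" using c0 k linked_trans by blast
      then have "weight w e0 \<le> weight w k" using e0 by (auto simp: M_def minimal_def)
      moreover have "weight w k \<le> weight w e0" using e0 k by (auto simp: M_def T_def)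
      ultimately have "weight w k = weight w e0" by simp
      then have "k \<in> M" using e0 k c linked_trans
        by (fastforce simp: M_def T_def minimal_def)
      then show ?thesis using r_eq[OF c] e0 by simp
    qed
    moreover have "k \<in> Poly_Mapping.keys f \<and> linked I \<rho> k" if "k \<in> M" "r k = \<rho>" for k
      using that r linked_sym by (auto simp: M_def T_def)
    ultimately show ?thesis by blast
  qed
  have nonmin: "(\<Sum>e\<in>T - M. Poly_Mapping.single e (Poly_Mapping.lookup f e)) \<in> ?J"
    by (intro ideal_gen_sum, subst single_eq_mult_monomial, intro ideal_gen_mult ideal_gen_base)
       (auto simp: initial_gens_def M_def)
  have diffs: "(\<Sum>e\<in>M. Poly_Mapping.single 0 (Poly_Mapping.lookup f e) * (monomial_of e - monomial_of (r e))) \<in> ?J"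
    by (intro ideal_gen_sum ideal_gen_mult ideal_gen_base)
       (use r in \<open>unfold initial_gens_def M_def, blast\<close>)
  have "(\<Sum>e\<in>M. Poly_Mapping.single (r e) (Poly_Mapping.lookup f e)) =
      (\<Sum>\<rho>\<in>r ` M. \<Sum>e\<in>{e \<in> M. r e = \<rho>}. Poly_Mapping.single (r e) (Poly_Mapping.lookup f e))"
    by (rule sum.image_gen[OF fin(2)])
  also have "\<dots> = (\<Sum>\<rho>\<in>r ` M. 0)"
  proof (rule sum.cong[OF refl])
    fix \<rho> assume \<rho>: "\<rho> \<in> r ` M"
    have "(\<Sum>e\<in>{e \<in> M. r e = \<rho>}. Poly_Mapping.single (r e) (Poly_Mapping.lookup f e))
        = Poly_Mapping.single \<rho> (\<Sum>e\<in>{e \<in> M. r e = \<rho>}. Poly_Mapping.lookup f e)"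
      by (auto intro!: poly_mapping_eqI simp: lookup_sum lookup_single when_def)
    also have "(\<Sum>e\<in>{e \<in> M. r e = \<rho>}. Poly_Mapping.lookup f e) = coeff_sum {e. linked I \<rho> e} f"
      unfolding coeff_sum_def class_keys[OF \<rho>] ..
    also have "\<dots> = 0" using f by (rule coeff_sum_class)
    finally show "(\<Sum>e\<in>{e \<in> M. r e = \<rho>}. Poly_Mapping.single (r e) (Poly_Mapping.lookup f e)) = 0"
      by simp
  qed
  finally have reps: "(\<Sum>e\<in>M. Poly_Mapping.single (r e) (Poly_Mapping.lookup f e)) = 0" by simp
  have "initial_form w f = (\<Sum>e\<in>T - M. Poly_Mapping.single e (Poly_Mapping.lookup f e)) +
      (\<Sum>e\<in>M. Poly_Mapping.single e (Poly_Mapping.lookup f e))"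
    unfolding initial_form_def T_def[symmetric]
    by (rule sum.subset_diff) (use fin in \<open>auto simp: M_def\<close>)
  also have "(\<Sum>e\<in>M. Poly_Mapping.single e (Poly_Mapping.lookup f e)) =
      (\<Sum>e\<in>M. Poly_Mapping.single 0 (Poly_Mapping.lookup f e) * (monomial_of e - monomial_of (r e)))"
    using reps by (simp add: right_diff_distrib sum_subtractf flip: single_eq_mult_monomial)
  finally show ?thesis using ideal_gen_add[OF nonmin diffs] by simp
qed

lemma initial_binomial_ideal:
  "initial_ideal w I = ideal_gen (initial_gens I w)"
  (is "?L = ?R")
proof
  show "?L \<subseteq> ?R"
    unfolding initial_ideal_def
    by (rule ideal_gen_subset) (auto intro: initial_form_in_initial_gens)
  show "?R \<subseteq> ?L"
    using initial_gens_subset[of w] ideal_gen_subset unfolding initial_ideal_def by blast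
qed

text \<open>For a minimal \<open>e\<close>, the coefficient sum over the minimal exponents in the class of \<open>e\<close> vanishes
  on the whole initial ideal, but not on \<open>x\<^sup>e\<close>.\<close>

lemma monomial_in_initial_ideal_iff:
  "monomial_of e \<in> initial_ideal w I \<longleftrightarrow>
   \<not> minimal (linked I) w e"
proof
  assume "monomial_of e \<in> initial_ideal w I"
  then have *: "monomial_of e \<in> ideal_gen (initial_gens I w)" by (simp add: initial_binomial_ideal)
  define S where "S = {e'. linked I e e' \<and> minimal (linked I) w e'}"
  have "coeff_sum S (monomial_of e :: ('n,'k) mpoly) = 0"
    using *
  proof (rule coeff_sum_eq_0_on_ideal)
    have nonmin: "\<not> minimal (linked I) w (g + a)" if a: "\<not> minimal (linked I) w a" for g a
    proof -
      from a obtain b where "linked I a b" "weight w b < weight w a"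
        by (auto simp: minimal_def not_le)
      then have "linked I (g + a) (g + b)" "weight w (g + b) < weight w (g + a)"
        by (simp_all add: linked_translate weight_add)
      then show ?thesis by (auto simp: minimal_def not_le)
    qed
    have transfer: "g + b \<in> S" if "linked I a b" "weight w a = weight w b" "g + a \<in> S" for g a b
    proof -
      have c: "linked I (g + a) (g + b)" using that by (simp add: linked_translate)
      have "linked I e (g + b)" using that c linked_trans unfolding S_def by blast
      moreover have "minimal (linked I) w (g + b)"
        using that c linked_trans unfolding S_def minimal_def by (fastforce simp: weight_add)
      ultimately show ?thesis by (simp add: S_def)
    qed
    fix b assume "b \<in> initial_gens I w"
    then consider a where "b = monomial_of a" "\<not> minimal (linked I) w a"
      | a a' where "b = monomial_of a - monomial_of a'" "linked I a a'" "minimal (linked I) w a" "minimal (linked I) w a'"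
      unfolding initial_gens_def by blast
    then show "(\<exists>a. b = monomial_of a \<and> (\<forall>g. g + a \<notin> S)) \<or>
      (\<exists>a a'. b = monomial_of a - monomial_of a' \<and> (\<forall>g. g + a \<in> S \<longleftrightarrow> g + a' \<in> S))"
    proof cases
      case 1 then show ?thesis using nonmin by (auto simp: S_def)
    next
      case 2
      then have "weight w a = weight w a'" using minimal_weight_eq by blast
      then show ?thesis using 2 transfer[of a a'] transfer[of a' a] linked_sym[OF 2(2)] by metis
    qed
  qed
  then show "\<not> minimal (linked I) w e"
    by (auto simp: S_def monomial_of_def coeff_sum_single linked_refl split: if_splits)
next
  assume "\<not> minimal (linked I) w e"
  then show "monomial_of e \<in> initial_ideal w I"
    using initial_gens_subset[of w] by (auto simp: initial_gens_def)
qed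

theorem initial_ideal_eq_iff_minimal:
  "initial_ideal u I = initial_ideal v I \<longleftrightarrow>
   (\<forall>e. minimal (linked I) u e \<longleftrightarrow> minimal (linked I) v e)"
proof
  assume "initial_ideal u I = initial_ideal v I"
  then show "\<forall>e. minimal (linked I) u e \<longleftrightarrow> minimal (linked I) v e"
    by (metis monomial_in_initial_ideal_iff)
next
  assume "\<forall>e. minimal (linked I) u e \<longleftrightarrow> minimal (linked I) v e"
  then show "initial_ideal u I = initial_ideal v I"
    by (simp add: initial_binomial_ideal initial_gens_def)
qed

end

section \<open>Finiteness of fibres\<close>

text \<open>A weakly decreasing sequence of natural numbers is eventually constant, so a monotone
  subsequence can always be made increasing.\<close>

lemma nat_seq_mono_subseq:
  fixes x :: "nat \<Rightarrow> nat"
  shows "\<exists>s :: nat \<Rightarrow> nat. strict_mono s \<and> mono (x \<circ> s)"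
proof -
  obtain s where s: "strict_mono s" "monoseq (\<lambda>n. x (s n))" using seq_monosub by blast
  show ?thesis
  proof (cases "mono (x \<circ> s)")
    case True then show ?thesis using s by blast
  next
    case False
    then have dec: "x (s n) \<le> x (s m)" if "m \<le> n" for m n
      using s(2) that by (auto simp: monoseq_def mono_def)
    define N where "N = (ARG_MIN (\<lambda>n. x (s n)) n. True)"
    have "x (s N) \<le> x (s n)" for n
      unfolding N_def by (rule arg_min_nat_le) simp
    then have "x (s (N + k)) = x (s N)" for k using dec[of N "N + k"] by (simp add: order.antisym)
    then have "mono (x \<circ> (\<lambda>k. s (N + k)))" by (simp add: mono_def)
    moreover have "strict_mono (\<lambda>k. s (N + k))" using s(1) by (simp add: strict_mono_def)
    ultimately show ?thesis by blast
  qed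
qed

text \<open>Dickson's lemma: pass to increasing subsequences one coordinate at a time.\<close>

lemma infinite_nat_vec_comparable:
  fixes S :: "(nat^'n::finite) set"
  assumes "infinite S"
  shows "\<exists>a\<in>S. \<exists>b\<in>S. a \<noteq> b \<and> (\<forall>i. a $ i \<le> b $ i)"
proof -
  obtain f :: "nat \<Rightarrow> nat^'n" where f: "inj f" "range f \<subseteq> S"
    using assms infinite_countable_subset by blast
  have "\<exists>r :: nat \<Rightarrow> nat. strict_mono r \<and> (\<forall>i\<in>J. mono (\<lambda>k. f (r k) $ i))" if "finite J" for J :: "'n set"
    using that
  proof (induction J rule: finite_induct)
    case empty
    have "strict_mono (\<lambda>k::nat. k)" by (simp add: strict_mono_def)
    then show ?case by auto
  next
    case (insert j J)
    then obtain r :: "nat \<Rightarrow> nat" where r: "strict_mono r" "\<forall>i\<in>J. mono (\<lambda>k. f (r k) $ i)" by blast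
    obtain s :: "nat \<Rightarrow> nat" where s: "strict_mono s" "mono ((\<lambda>k. f (r k) $ j) \<circ> s)"
      using nat_seq_mono_subseq by blast
    have "mono (\<lambda>k. f ((r \<circ> s) k) $ i)" if "i \<in> insert j J" for i
      using that r(2) s strict_mono_mono[OF s(1)] by (auto simp: mono_def)
    then show ?case using strict_mono_o[OF r(1) s(1)] by blast
  qed
  from this[of UNIV] obtain r :: "nat \<Rightarrow> nat" where r: "strict_mono r" "\<And>i. mono (\<lambda>k. f (r k) $ i)" by auto
  have "f (r 0) \<noteq> f (r 1)"
    using f(1) strict_monoD[OF r(1), of 0 1] by (auto dest: injD)
  then show ?thesis using r(2) f(2) by (metis monoD range_subsetD zero_le_one)
qed

definition zvec :: "nat^'n \<Rightarrow> int^'n" where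
  "zvec e = (\<chi> i. int (e $ i))"

definition rvec :: "int^'n \<Rightarrow> real^'n" where
  "rvec p = (\<chi> i. real_of_int (p $ i))"

lemma zvec_nth [simp]: "zvec e $ i = int (e $ i)" by (simp add: zvec_def)

lemma rvec_nth [simp]: "rvec p $ i = real_of_int (p $ i)" by (simp add: rvec_def)

lemma rvec_minus: "rvec (- p) = - rvec p" by (simp add: vec_eq_iff)

lemma rvec_0 [simp]: "rvec 0 = 0" by (simp add: vec_eq_iff)

lemma rvec_eq_0_iff [simp]: "rvec p = 0 \<longleftrightarrow> p = 0" by (simp add: vec_eq_iff)

lemma zvec_add: "zvec (a + b) = zvec a + zvec b" by (simp add: vec_eq_iff)

lemma zvec_inj: "zvec a = zvec b \<Longrightarrow> a = b" by (simp add: vec_eq_iff)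

lemma nonneg_imp_zvec: "(\<And>i. 0 \<le> z $ i) \<Longrightarrow> \<exists>e. zvec e = z"
  by (rule exI[of _ "\<chi> i. nat (z $ i)"]) (simp add: vec_eq_iff)

lemma weight_diff: "weight w a - weight w b = w \<bullet> rvec (zvec a - zvec b)"
  by (simp add: weight_def inner_vec_def sum_subtractf algebra_simps)

lemma zvec_pos_neg: "zvec (pos_part u) - zvec (neg_part u) = u"
  by (auto simp: vec_eq_iff pos_part_def neg_part_def)

lemma lattice_iff: "u \<in> lattice_of A \<longleftrightarrow> (\<forall>i. (\<Sum>j\<in>UNIV. A $ i $ j * u $ j) = 0)"
  by (simp add: lattice_of_def matrix_vector_mult_def vec_eq_iff)

lemma lattice_0: "0 \<in> lattice_of A" by (simp add: lattice_iff)

lemma lattice_diff: "u \<in> lattice_of A \<Longrightarrow> v \<in> lattice_of A \<Longrightarrow> u - v \<in> lattice_of A"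
  by (simp add: lattice_iff right_diff_distrib sum_subtractf)

lemma lattice_minus: "u \<in> lattice_of A \<Longrightarrow> - u \<in> lattice_of A"
  using lattice_diff[OF lattice_0, of u A] by simp

lemma lattice_add: "u \<in> lattice_of A \<Longrightarrow> v \<in> lattice_of A \<Longrightarrow> u + v \<in> lattice_of A"
  using lattice_diff[of u A "- v"] lattice_minus[of v A] by simp

lemma smult_row_sum:
  "(\<Sum>j\<in>UNIV. A $ i $ j * (k *s u) $ j) = k * (\<Sum>j\<in>UNIV. A $ i $ j * u $ j)"
  for A :: "int^'n^'d"
  by (simp add: sum_distrib_left mult.left_commute)

lemma lattice_smult: "u \<in> lattice_of A \<Longrightarrow> k *s u \<in> lattice_of A"
  unfolding lattice_iff smult_row_sum by simp

lemma lattice_smult_cancel: "k *s u \<in> lattice_of A \<Longrightarrow> k \<noteq> 0 \<Longrightarrow> u \<in> lattice_of A"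
  unfolding lattice_iff smult_row_sum by simp

definition fibre_rel :: "int^'n^'d \<Rightarrow> nat^'n \<Rightarrow> nat^'n \<Rightarrow> bool" where
  "fibre_rel A e e' \<longleftrightarrow> zvec e - zvec e' \<in> lattice_of A"

lemma fibre_rel_sym: "fibre_rel A e e' \<Longrightarrow> fibre_rel A e' e"
  unfolding fibre_rel_def using lattice_minus[of "zvec e - zvec e'" A] by simp

lemma fibre_rel_trans: "fibre_rel A a b \<Longrightarrow> fibre_rel A b c \<Longrightarrow> fibre_rel A a c"
  unfolding fibre_rel_def using lattice_add[of "zvec a - zvec b" A "zvec b - zvec c"] by simp

text \<open>Two comparable points of one fibre differ by a nonnegative lattice vector, hence coincide.\<close>

lemma finite_fibre:
  fixes A :: "int^'n::finite^'d"
  assumes "lattice_of A \<inter> {u. \<forall>i. 0 \<le> u $ i} = {0}"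
  shows "finite {e'. fibre_rel A e e'}"
proof (rule ccontr)
  assume "infinite {e'. fibre_rel A e e'}"
  then obtain a b where ab: "fibre_rel A e a" "fibre_rel A e b" "a \<noteq> b" "\<forall>i. a $ i \<le> b $ i"
    using infinite_nat_vec_comparable[of "{e'. fibre_rel A e e'}"] by auto
  then have "fibre_rel A b a" using fibre_rel_trans[OF fibre_rel_sym] by blast
  then have "zvec b - zvec a \<in> lattice_of A" by (simp add: fibre_rel_def)
  moreover have "\<forall>i. 0 \<le> (zvec b - zvec a) $ i" using ab(4) by simp
  ultimately have "zvec b - zvec a = 0" using assms by blast
  then show False using ab(3) zvec_inj by auto
qed

section \<open>Circuits of a rank two lattice\<close>

locale codim2 =
  fixes A :: "int^'n::finite^'d::finite"
  assumes full_rank: "rank (map_matrix real_of_int A) = CARD('d)"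
    and pointed: "lattice_of A \<inter> {u. \<forall>i. 0 \<le> u $ i} = {0}"
    and codim: "int CARD('n) - int CARD('d) = 2"
begin

text \<open>Rank two enters only here: the real kernel of \<open>A\<close> is a plane, so two independent lattice vectors
  span it.\<close>

lemma lattice_plane:
  assumes L: "q \<in> lattice_of A" "h \<in> lattice_of A" "p \<in> lattice_of A"
    and indep: "\<And>a b. a *\<^sub>R rvec q + b *\<^sub>R rvec h = 0 \<Longrightarrow> a = 0 \<and> b = 0"
  shows "\<exists>x y. rvec p = x *\<^sub>R rvec q + y *\<^sub>R rvec h"
proof -
  define M where "M = map_matrix real_of_int A"
  define N where "N = {y. \<forall>x\<in>span (rows M). orthogonal x y}"
  have "dim N + dim (span (rows M)) = CARD('n)"
    using dim_subspace_orthogonal_to_vectors[of "span (rows M)" "UNIV :: (real^'n) set"]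
    by (simp add: N_def)
  moreover have "dim (rows M) = CARD('d)"
    using full_rank by (simp add: M_def row_rank_def)
  ultimately have dimN: "dim N = 2" using codim by simp
  have subN: "subspace N" unfolding N_def
    by (auto simp: subspace_def orthogonal_def inner_right_distrib)
  have in_N: "rvec u \<in> N" if "u \<in> lattice_of A" for u
  proof -
    have "orthogonal r (rvec u)" if "r \<in> rows M" for r
    proof -
      from that obtain i where "r = row i M" by (auto simp: rows_def)
      then have "r \<bullet> rvec u = real_of_int (\<Sum>j\<in>UNIV. A $ i $ j * u $ j)"
        by (simp add: inner_vec_def row_def M_def map_matrix_def)
      moreover have "(\<Sum>j\<in>UNIV. A $ i $ j * u $ j) = 0"
        using \<open>u \<in> lattice_of A\<close> by (simp add: lattice_iff)
      ultimately show ?thesis by (simp only: orthogonal_def of_int_0)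
    qed
    then have "orthogonal x (rvec u)" if "x \<in> span (rows M)" for x
      using orthogonal_to_span[of x "rows M" "rvec u"] that by (simp add: orthogonal_commute)
    then show ?thesis by (simp add: N_def)
  qed
  have neq: "rvec q \<noteq> rvec h" using indep[of 1 "-1"] by auto
  have "independent {rvec q, rvec h}"
  proof -
    have "rvec h \<noteq> 0" using indep[of 0 1] by auto
    moreover have "rvec q \<notin> span {rvec h}"
    proof
      assume "rvec q \<in> span {rvec h}"
      then obtain k where "rvec q = k *\<^sub>R rvec h" by (auto simp: span_singleton)
      then show False using indep[of 1 "-k"] by simp
    qed
    ultimately show ?thesis using neq by (simp add: independent_insert)
  qed
  then have "N \<subseteq> span {rvec q, rvec h}"
    using card_ge_dim_independent[of "{rvec q, rvec h}" N] in_N L neq dimN by simp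
  then have "rvec p \<in> span {rvec q, rvec h}" using in_N L by blast
  then obtain x y where "rvec p - x *\<^sub>R rvec q = y *\<^sub>R rvec h"
    by (auto simp: span_breakdown_eq)
  then show ?thesis by (metis add.commute diff_add_cancel)
qed

lemma primitive_multiple:
  fixes d :: "int^'n"
  assumes d: "d \<in> lattice_of A" "d \<noteq> 0"
    and min: "\<And>f. f \<in> lattice_of A \<Longrightarrow> f \<noteq> 0 \<Longrightarrow> \<not> vsupp f \<subset> vsupp d"
  shows "\<exists>c k. circuit A c \<and> d = k *s c"
proof -
  define k where "k = Gcd (range (\<lambda>i. d $ i))"
  define c where "c = (\<chi> i. d $ i div k)"
  have "k dvd d $ i" for i unfolding k_def by (rule Gcd_dvd) simp
  then have dc: "d = k *s c" by (simp add: vec_eq_iff c_def)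
  then have k0: "k \<noteq> 0" using d by auto
  have "k * Gcd (range (\<lambda>i. c $ i)) = Gcd (range (\<lambda>i. k * c $ i))"
    using Gcd_mult[of k "range (\<lambda>i. c $ i)"] by (simp add: image_image k_def)
  also have "range (\<lambda>i. k * c $ i) = range (\<lambda>i. d $ i)" by (simp add: dc)
  also have "Gcd \<dots> = k" by (simp add: k_def)
  finally have "Gcd (range (\<lambda>i. c $ i)) = 1" using k0 by simp
  moreover have "vsupp c = vsupp d" using k0 by (simp add: dc vsupp_def)
  moreover have "c \<in> lattice_of A" "c \<noteq> 0"
    using d dc k0 lattice_smult_cancel by auto
  ultimately have "circuit A c" using min by (auto simp: circuit_def)
  then show ?thesis using dc by blast
qed

lemma circuit_exists:
  assumes "q \<in> lattice_of A" "q \<noteq> 0"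
  shows "\<exists>c. circuit A c"
proof -
  obtain d where d: "d \<in> lattice_of A \<and> d \<noteq> 0"
    and min: "\<And>f. f \<in> lattice_of A \<and> f \<noteq> 0 \<Longrightarrow> card (vsupp d) \<le> card (vsupp f)"
    using ex_has_least_nat[of "\<lambda>d. d \<in> lattice_of A \<and> d \<noteq> 0" q "\<lambda>d. card (vsupp d)"] assms
    by blast
  have "\<not> vsupp f \<subset> vsupp d" if "f \<in> lattice_of A" "f \<noteq> 0" for f
  proof
    assume "vsupp f \<subset> vsupp d"
    then have "card (vsupp f) < card (vsupp d)" by (simp add: psubset_card_mono)
    then show False using min[of f] that by simp
  qed
  then show ?thesis using primitive_multiple[of d] d by blast
qed

text \<open>If some lattice vector is nonzero at \<open>i\<close>, then those that vanish at \<open>i\<close> lie on a line. Hence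
  the nonzero ones among them all have the same support, which is therefore minimal.\<close>

lemma zero_coord_multiple_of_circuit:
  assumes d: "d \<in> lattice_of A" "d \<noteq> 0" "d $ i = 0" and h: "h \<in> lattice_of A" "h $ i \<noteq> 0"
  shows "\<exists>c k. circuit A c \<and> d = k *s c"
proof (rule primitive_multiple[OF d(1,2)])
  fix f assume f: "f \<in> lattice_of A" "f \<noteq> 0"
  show "\<not> vsupp f \<subset> vsupp d"
  proof
    assume sub: "vsupp f \<subset> vsupp d"
    then have "f $ i = 0" using d(3) by (auto simp: vsupp_def)
    have "a = 0 \<and> b = 0" if "a *\<^sub>R rvec d + b *\<^sub>R rvec h = 0" for a b
    proof -
      have "(a *\<^sub>R rvec d + b *\<^sub>R rvec h) $ i = 0" using that by simp
      then have "b = 0" using d h by simp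
      then show ?thesis using that d by simp
    qed
    then obtain x y where xy: "rvec f = x *\<^sub>R rvec d + y *\<^sub>R rvec h"
      using lattice_plane[OF d(1) h(1) f(1)] by blast
    then have "rvec f $ i = (x *\<^sub>R rvec d + y *\<^sub>R rvec h) $ i" by simp
    then have "y = 0" using d h \<open>f $ i = 0\<close> by simp
    then have f_eq: "rvec f = x *\<^sub>R rvec d" using xy by simp
    then have "x \<noteq> 0" using f by auto
    have "real_of_int (f $ j) = x * real_of_int (d $ j)" for j
      using arg_cong[OF f_eq, of "\<lambda>z. z $ j"] by simp
    then have "f $ j = 0 \<longleftrightarrow> d $ j = 0" for j
      using \<open>x \<noteq> 0\<close> by (metis mult_eq_0_iff of_int_eq_0_iff)
    then show False using sub by (auto simp: vsupp_def)
  qed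
qed

end

section \<open>Connecting lattice points by circuits\<close>

text \<open>Of the congruence defined by the circuit ideal, the connectivity arguments use only that it is
  a translation-invariant equivalence containing the circuits.\<close>

locale circuit_congruence = codim2 A
  for A :: "int^'n::finite^'d::finite" +
  fixes R :: "nat^'n \<Rightarrow> nat^'n \<Rightarrow> bool"
  assumes R_refl: "R e e"
    and R_sym: "R e e' \<Longrightarrow> R e' e"
    and R_trans: "R a b \<Longrightarrow> R b b' \<Longrightarrow> R a b'"
    and R_translate: "R a b \<Longrightarrow> R (g + a) (g + b)"
    and R_circuit: "circuit A c \<Longrightarrow> R (pos_part c) (neg_part c)"
begin

lemma R_add: "R a b \<Longrightarrow> R a' b' \<Longrightarrow> R (a + a') (b + b')"
  using R_translate[of a' b' a] R_translate[of a b b'] R_trans by (metis add.commute)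

text \<open>There are two strengths of connection by a vector \<open>d\<close>: \<open>moves\<close> allows the step from every point of
  the orthant for which it stays in the orthant, whereas \<open>joins\<close> asks for one place, so that the step is
  possible above it.\<close>

definition moves :: "int^'n \<Rightarrow> bool" where
  "moves d \<longleftrightarrow> (\<forall>e e'. zvec e - zvec e' = d \<longrightarrow> R e e')"

definition joins :: "int^'n \<Rightarrow> bool" where
  "joins d \<longleftrightarrow> (\<exists>e e'. zvec e - zvec e' = d \<and> R e e')"

lemma moves_minus: "moves d \<Longrightarrow> moves (- d)"
proof -
  assume d: "moves d"
  have "R e e'" if "zvec e - zvec e' = - d" for e e'
  proof -
    have "zvec e' - zvec e = d" using that by (metis minus_diff_eq minus_minus)
    then show ?thesis using d R_sym unfolding moves_def by blast
  qed
  then show "moves (- d)" by (simp add: moves_def)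
qed

lemma moves_imp_joins: "moves d \<Longrightarrow> joins d"
  unfolding moves_def joins_def using zvec_pos_neg by blast

text \<open>The intermediate points of repeated subtraction lie on the segment between the two endpoints,
  so they stay in the orthant.\<close>

lemma moves_multiple_of_circuit:
  assumes c: "circuit A c"
  shows "moves (k *s c)"
proof -
  have pow: "R (\<chi> i. m * pos_part c $ i) (\<chi> i. m * neg_part c $ i)" for m
  proof (induction m)
    case 0 show ?case by (simp add: R_refl)
  next
    case (Suc m)
    have "(\<chi> i. Suc m * x $ i) = (\<chi> i. m * x $ i) + x" for x :: "nat^'n"
      by (simp add: vec_eq_iff)
    then show ?case using R_add[OF Suc R_circuit[OF c]] by simp
  qed
  have nonneg: "moves (int m *s c)" for m
    unfolding moves_def
  proof (intro allI impI)
    fix e e' assume "zvec e - zvec e' = int m *s c"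
    then have eq: "int (e $ i) - int (e' $ i) = int m * c $ i" for i
      by (metis vector_minus_component vector_smult_component zvec_nth)
    define g where "g = (\<chi> i. e $ i - m * pos_part c $ i)"
    have ge: "m * pos_part c $ i \<le> e $ i" for i
    proof (cases "0 \<le> c $ i")
      case True
      then have "int (m * pos_part c $ i) = int m * c $ i" by (simp add: pos_part_def)
      then show ?thesis using eq[of i] by linarith
    qed (simp add: pos_part_def)
    have e: "e = g + (\<chi> i. m * pos_part c $ i)" using ge by (simp add: g_def vec_eq_iff)
    have "int (e' $ i) = int ((g + (\<chi> i. m * neg_part c $ i)) $ i)" for i
      using eq[of i] ge[of i]
      by (cases "0 \<le> c $ i") (simp_all add: g_def pos_part_def neg_part_def of_nat_diff)
    then have "e' = g + (\<chi> i. m * neg_part c $ i)" by (simp only: vec_eq_iff of_nat_eq_iff) simp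
    then show "R e e'" using e R_translate[OF pow] by simp
  qed
  show ?thesis
  proof (cases "0 \<le> k")
    case True then show ?thesis using nonneg[of "nat k"] by simp
  next
    case False
    have "- (int (nat (- k)) *s c) = k *s c" using False by (simp add: vec_eq_iff)
    then show ?thesis using moves_minus[OF nonneg[of "nat (- k)"]] by simp
  qed
qed

lemma moves_zero_coord:
  assumes "d \<in> lattice_of A" "d $ i = 0" "h \<in> lattice_of A" "h $ i \<noteq> 0"
  shows "moves d"
proof (cases "d = 0")
  case True
  then show ?thesis unfolding moves_def by (auto dest: zvec_inj intro: R_refl)
next
  case False
  then show ?thesis using zero_coord_multiple_of_circuit assms moves_multiple_of_circuit by metis
qed

lemma joins_add:
  assumes "joins p" "joins q"
  shows "joins (p + q)"
proof -
  obtain a a' b b' where "zvec a - zvec a' = p" "R a a'" "zvec b - zvec b' = q" "R b b'"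
    using assms unfolding joins_def by blast
  moreover from this have "zvec (a + b) - zvec (a' + b') = p + q" by (auto simp: zvec_add)
  ultimately show ?thesis unfolding joins_def using R_add by blast
qed

lemma joins_minus: "joins p \<Longrightarrow> joins (- p)"
  unfolding joins_def by (metis R_sym minus_diff_eq)

lemma joins_diff: "joins p \<Longrightarrow> joins q \<Longrightarrow> joins (p - q)"
  using joins_add joins_minus by (metis diff_conv_add_uminus)

lemma joins_0: "joins 0"
  unfolding joins_def using R_refl by auto

text \<open>The vectors \<open>d\<close> with \<open>joins d\<close> form a group that contains the circuits, and the circuits generate the
  lattice. To see this, fix one circuit \<open>c\<close>. For each \<open>i\<close> the vector
  \<open>c\<^sub>i h - h\<^sub>i c\<close> vanishes at \<open>i\<close>, so it is a multiple of a circuit, and with it \<open>c\<^sub>i h\<close> is in the group.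
  Because the entries of \<open>c\<close> have greatest common divisor one, so is \<open>h\<close>.\<close>

lemma joins_lattice:
  assumes h: "h \<in> lattice_of A"
  shows "joins h"
proof (cases "h = 0")
  case True then show ?thesis using joins_0 by simp
next
  case False
  then obtain c where c: "circuit A c" using circuit_exists h by blast
  then have cL: "c \<in> lattice_of A" and gcd: "Gcd (range (\<lambda>i. c $ i)) = 1"
    by (auto simp: circuit_def)
  have jc: "joins (k *s c)" for k using moves_multiple_of_circuit[OF c] moves_imp_joins by blast
  have coord: "joins (c $ i *s h)" for i
  proof -
    define d where "d = c $ i *s h - h $ i *s c"
    have "joins d"
    proof (cases "c $ i = 0 \<and> h $ i = 0")
      case True
      then show ?thesis using joins_0 by (simp add: d_def)
    next
      case False
      have "d \<in> lattice_of A" unfolding d_def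
        using h cL by (intro lattice_diff lattice_smult)
      moreover have "d $ i = 0" by (simp add: d_def)
      ultimately show ?thesis using moves_zero_coord False h cL moves_imp_joins by blast
    qed
    then show ?thesis using joins_add[OF _ jc[of "h $ i"], of d] by (simp add: d_def)
  qed
  have "joins (a *s h)" if "a \<in> group_closure (range (\<lambda>i. c $ i))" for a
    using that
  proof induction
    case base then show ?case using coord joins_0 by auto
  next
    case (diff s t)
    have "(s - t) *s h = s *s h - t *s h" by (simp add: vec_eq_iff algebra_simps)
    then show ?case using joins_diff diff by simp
  qed
  then show ?thesis using Gcd_in_group_closure[of "range (\<lambda>i. c $ i)"] gcd by fastforce
qed

lemma R_if_above_join:
  assumes "zvec a - zvec a' = q" "R a a'" "\<And>i. a $ i \<le> e $ i" "zvec e - zvec e' = q"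
  shows "R e e'"
proof -
  define g where "g = (\<chi> i. e $ i - a $ i)"
  have e: "e = g + a" using assms(3) by (simp add: g_def vec_eq_iff)
  then have "zvec e' = zvec (g + a')" using assms(1,4) by (simp add: zvec_add algebra_simps)
  then have "e' = g + a'" by (rule zvec_inj)
  then show ?thesis using e R_translate[OF assms(2)] by simp
qed

text \<open>The endpoints \<open>e\<close> and \<open>e - q\<close> are as low as possible in the coordinates \<open>i\<close> and \<open>j\<close>, and very large
  elsewhere. From both, first move by \<open>- d\<close>, which keeps coordinate \<open>i\<close> and raises coordinate \<open>j\<close>, and
  then by \<open>d'\<close>, which keeps \<open>j\<close> and raises \<open>i\<close>. The two resulting points lie above a place where \<open>q\<close> is
  joined.\<close>

lemma join_from_corner:
  assumes q: "q \<in> lattice_of A" "q $ i > 0" "q $ j < 0"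
    and h: "h \<in> lattice_of A" and nonpar: "h $ i * q $ j \<noteq> q $ i * h $ j"
  shows "\<exists>e e'. zvec e - zvec e' = q \<and> R e e' \<and> int (e $ i) = q $ i \<and> e $ j = 0"
proof -
  obtain a a' where a: "zvec a - zvec a' = q" "R a a'"
    using joins_lattice[OF q(1)] unfolding joins_def by blast
  \<comment> \<open>Large enough to lift the coordinates \<open>i\<close> and \<open>j\<close> above those of \<open>a\<close>.\<close>
  define T where "T = int (a $ i + a $ j)"
  define D where "D = q $ i * h $ j - h $ i * q $ j"
  have D: "D \<noteq> 0" using nonpar by (simp add: D_def)
  \<comment> \<open>The factor \<open>D\<close> fixes the signs: it makes \<open>d\<close> at most \<open>- T\<close> at \<open>j\<close> and \<open>d'\<close> at least \<open>T\<close> at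
    \<open>i\<close>, whatever the orientation of \<open>q\<close> and \<open>h\<close>.\<close>
  define d where "d = (T * D) *s (h $ i *s q - q $ i *s h)"
  define d' where "d' = (T * D) *s (h $ j *s q - q $ j *s h)"
  have dL: "d \<in> lattice_of A" "d' \<in> lattice_of A"
    unfolding d_def d'_def using q h by (auto intro!: lattice_smult lattice_diff)
  have sq: "1 \<le> D * D" using D by (simp add: int_one_le_iff_zero_less zero_less_mult_iff) linarith
  have T0: "0 \<le> T" by (simp add: T_def)
  have "T \<le> T * (D * D)" using mult_left_mono[OF sq T0] by simp
  moreover have "d $ j = - (T * (D * D))" by (simp add: d_def D_def algebra_simps)
  moreover have "d' $ i = T * (D * D)" by (simp add: d'_def D_def algebra_simps)
  ultimately have dj: "d $ j \<le> - T" and d'i: "T \<le> d' $ i" by simp_all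
  have di: "d $ i = 0" and d'j: "d' $ j = 0" by (simp_all add: d_def d'_def)
  have mv: "moves d" "moves d'"
    using moves_zero_coord[OF dL(1) di q(1)] moves_zero_coord[OF dL(2) d'j q(1)] q(2,3) by auto
  define z where "z = (\<chi> k. if k = i then q $ i else if k = j then 0
     else \<bar>d $ k\<bar> + \<bar>d' $ k\<bar> + \<bar>q $ k\<bar> + int (a $ k))"
  have ij: "i \<noteq> j" using q by auto
  have zi: "z $ i = q $ i" and zj: "z $ j = 0" using ij by (auto simp: z_def)
  have zk: "z $ k = \<bar>d $ k\<bar> + \<bar>d' $ k\<bar> + \<bar>q $ k\<bar> + int (a $ k)" if "k \<noteq> i" "k \<noteq> j" for k
    using that by (simp add: z_def)
  have aT: "int (a $ i) \<le> T" "int (a $ j) \<le> T" by (simp_all add: T_def)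
  have nn: "0 \<le> z $ k \<and> 0 \<le> z $ k - d $ k + d' $ k \<and> 0 \<le> z $ k - d $ k \<and> int (a $ k) \<le> z $ k - d $ k + d' $ k \<and>
    0 \<le> z $ k - q $ k \<and> 0 \<le> z $ k - q $ k - d $ k \<and> 0 \<le> z $ k - q $ k - d $ k + d' $ k" for k
  proof -
    consider "k = i" | "k = j" | "k \<noteq> i" "k \<noteq> j" by blast
    then show ?thesis
    proof cases
      case 1
      then show ?thesis using zi di d'i aT T0 q by auto
    next
      case 2
      then show ?thesis using zj d'j dj aT T0 q by auto
    next
      case 3
      show ?thesis unfolding zk[OF 3] by linarith
    qed
  qed
  obtain e where e: "zvec e = z" using nonneg_imp_zvec[of z] nn by auto
  obtain e1 where e1: "zvec e1 = z - d" using nonneg_imp_zvec[of "z - d"] nn by auto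
  obtain e2 where e2: "zvec e2 = z - d + d'"
    using nonneg_imp_zvec[of "z - d + d'"] nn by auto
  obtain f where f: "zvec f = z - q" using nonneg_imp_zvec[of "z - q"] nn by auto
  obtain f1 where f1: "zvec f1 = z - q - d" using nonneg_imp_zvec[of "z - q - d"] nn by auto
  obtain f2 where f2: "zvec f2 = z - q - d + d'"
    using nonneg_imp_zvec[of "z - q - d + d'"] nn by auto
  have "R e e1" "R f f1" using mv(1) e e1 f f1 by (simp_all add: moves_def)
  moreover have "R e2 e1" "R f2 f1" using mv(2) e1 e2 f1 f2 by (simp_all add: moves_def)
  moreover have "R e2 f2"
  proof (rule R_if_above_join[OF a])
    show "a $ k \<le> e2 $ k" for k using nn[of k] arg_cong[OF e2, of "\<lambda>x. x $ k"] by simp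
    show "zvec e2 - zvec f2 = q" by (simp add: e2 f2)
  qed
  ultimately have "R e f" using R_trans R_sym by metis
  moreover have "zvec e - zvec f = q" by (simp add: e f)
  moreover have "int (e $ i) = q $ i" "e $ j = 0"
    using zi zj arg_cong[OF e, of "\<lambda>x. x $ i"] arg_cong[OF e, of "\<lambda>x. x $ j"] by simp_all
  ultimately show ?thesis by blast
qed

text \<open>Let \<open>h\<close> be a lattice vector with \<open>w \<bullet> h > 0\<close> and write lattice vectors as \<open>x q + y h\<close>; those with
  \<open>w\<close>-weight positive have \<open>y > 0\<close>. Among the conditions \<open>p\<^sub>k \<le> max q\<^sub>k 0\<close> that prevent this, those with
  \<open>q\<^sub>k > 0\<close> read \<open>x + y s\<^sub>k \<le> 1\<close> and those with \<open>q\<^sub>k < 0\<close> read \<open>x + y s\<^sub>k \<ge> 0\<close>, where \<open>s\<^sub>k = h\<^sub>k / q\<^sub>k\<close>.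
  For \<open>y > 0\<close> each family is implied by a single member, namely the one with the largest and the
  smallest \<open>s\<^sub>k\<close> respectively. The remaining coordinates may thus be raised without destroying
  minimality.\<close>

lemma exists_minimal_join:
  assumes q: "q \<in> lattice_of A" "q \<noteq> 0" "w \<bullet> rvec q = 0"
    and min: "\<And>p. p \<in> lattice_of A \<Longrightarrow> (\<forall>k. p $ k \<le> max (q $ k) 0) \<Longrightarrow> w \<bullet> rvec p \<le> 0"
  shows "\<exists>e e'. zvec e - zvec e' = q \<and> R e e' \<and>
    (\<forall>p\<in>lattice_of A. (\<forall>k. p $ k \<le> int (e $ k)) \<longrightarrow> w \<bullet> rvec p \<le> 0)"
proof (cases "\<forall>h\<in>lattice_of A. w \<bullet> rvec h = 0")
  case True
  then show ?thesis using joins_lattice[OF q(1)] unfolding joins_def by fastforce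
next
  case False
  then obtain h0 where h0: "h0 \<in> lattice_of A" "w \<bullet> rvec h0 \<noteq> 0" by blast
  define h where "h = (if w \<bullet> rvec h0 > 0 then h0 else - h0)"
  have h: "h \<in> lattice_of A" "w \<bullet> rvec h > 0"
    using h0 lattice_minus by (auto simp: h_def rvec_minus)
  show ?thesis
  proof (cases "\<exists>k. q $ k = 0 \<and> h $ k \<noteq> 0")
    case True
    \<comment> \<open>A lattice vector with such a zero entry is a multiple of a circuit.\<close>
    then have "moves q" using moves_zero_coord q(1) h(1) by blast
    then have "R (pos_part q) (neg_part q)" using zvec_pos_neg[of q] unfolding moves_def by blast
    moreover have "int (pos_part q $ k) = max (q $ k) 0" for k by (simp add: pos_part_def)
    ultimately show ?thesis using zvec_pos_neg[of q] min by metis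
  next
    case False
    then have hq: "h $ k = 0" if "q $ k = 0" for k using that by blast
    define s where "s k = real_of_int (h $ k) / real_of_int (q $ k)" for k
    have sk: "real_of_int (h $ k) = s k * real_of_int (q $ k)" for k
      using hq[of k] by (cases "q $ k = 0") (auto simp: s_def)
    have "\<exists>k. q $ k > 0"
    proof (rule ccontr)
      assume "\<nexists>k. q $ k > 0"
      then have "- q \<in> {u. \<forall>i. 0 \<le> u $ i}" by (auto simp: not_less)
      then have "- q = 0" using pointed lattice_minus[OF q(1)] by blast
      then show False using q(2) by simp
    qed
    then obtain i where i: "q $ i > 0" "\<And>k. q $ k > 0 \<Longrightarrow> s k \<le> s i"
      using ex_is_arg_min_if_finite[of "{k. q $ k > 0}" "\<lambda>k. - s k"]
      by (auto simp: is_arg_min_linorder)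
    have "\<exists>k. q $ k < 0"
    proof (rule ccontr)
      assume "\<nexists>k. q $ k < 0"
      then have "q \<in> {u. \<forall>i. 0 \<le> u $ i}" by (auto simp: not_less)
      then show False using pointed q by blast
    qed
    then obtain j where j: "q $ j < 0" "\<And>k. q $ k < 0 \<Longrightarrow> s j \<le> s k"
      using ex_is_arg_min_if_finite[of "{k. q $ k < 0}" s]
      by (auto simp: is_arg_min_linorder)
    have nonpar: "h $ i * q $ j \<noteq> q $ i * h $ j"
    proof
      \<comment> \<open>If the two slopes agreed, the vector \<open>h\<^sub>i q - q\<^sub>i h\<close> would be nonnegative.\<close>
      assume par: "h $ i * q $ j = q $ i * h $ j"
      then have "real_of_int (h $ i) * q $ j = real_of_int (q $ i) * h $ j"
        by (metis of_int_mult)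
      then have sij: "s i = s j" using i j sk[of i] sk[of j] by simp
      define p where "p = h $ i *s q - q $ i *s h"
      have pL: "p \<in> lattice_of A" unfolding p_def using q h by (intro lattice_diff lattice_smult)
      have "0 \<le> p $ k" for k
      proof -
        have "real_of_int (p $ k) = q $ i * (q $ k * (s i - s k))"
          by (simp add: p_def sk[of i] sk[of k] algebra_simps)
        moreover have "0 \<le> q $ k * (s i - s k)"
          using i(2)[of k] j(2)[of k] sij
          by (cases "q $ k" "0 :: int" rule: linorder_cases) (auto intro: mult_nonpos_nonpos)
        ultimately have "0 \<le> real_of_int (p $ k)" using i(1) by simp
        then show ?thesis by simp
      qed
      then have "p = 0" using pL pointed by blast
      then have "h $ i *s q = q $ i *s h" by (simp add: p_def)
      then have "h $ i * q $ k = q $ i * h $ k" for k by (metis vector_smult_component)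
      then have "real_of_int (h $ i) *\<^sub>R rvec q = real_of_int (q $ i) *\<^sub>R rvec h"
        by (simp add: vec_eq_iff flip: of_int_mult)
      then have "real_of_int (h $ i) * (w \<bullet> rvec q) = real_of_int (q $ i) * (w \<bullet> rvec h)"
        by (metis inner_scaleR_right)
      then show False using q(3) i(1) h(2) by simp
    qed
    obtain e e' where e: "zvec e - zvec e' = q" "R e e'" "int (e $ i) = q $ i" "e $ j = 0"
      using join_from_corner[OF q(1) i(1) j(1) h(1) nonpar] by blast
    have "w \<bullet> rvec p \<le> 0" if p: "p \<in> lattice_of A" "\<forall>k. p $ k \<le> int (e $ k)" for p
    proof (rule ccontr)
      assume "\<not> w \<bullet> rvec p \<le> 0"
      then have wp: "w \<bullet> rvec p > 0" by simp
      have "a = 0 \<and> b = 0" if ab: "a *\<^sub>R rvec q + b *\<^sub>R rvec h = 0" for a b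
      proof -
        have "w \<bullet> (a *\<^sub>R rvec q + b *\<^sub>R rvec h) = 0" by (simp add: ab)
        then have "b = 0" using q h by (simp add: inner_add_right)
        then show ?thesis using ab q by simp
      qed
      then obtain x y where xy: "rvec p = x *\<^sub>R rvec q + y *\<^sub>R rvec h"
        using lattice_plane[OF q(1) h(1) p(1)] by blast
      then have "w \<bullet> rvec p = y * (w \<bullet> rvec h)" using q by (simp add: inner_add_right)
      then have y: "y > 0" using wp h(2) by (simp add: zero_less_mult_iff)
      have pk: "real_of_int (p $ k) = q $ k * (x + y * s k)" for k
        using arg_cong[OF xy, of "\<lambda>z. z $ k"] sk[of k] by (simp add: algebra_simps)
      have "p $ i \<le> q $ i" "p $ j \<le> 0" using p(2) e(3,4) by (metis, metis of_nat_0)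
      then have "real_of_int (q $ i) * (x + y * s i) \<le> q $ i * 1" "real_of_int (q $ j) * (x + y * s j) \<le> 0"
        using pk[of i] pk[of j] by simp_all
      then have xi: "x + y * s i \<le> 1" and xj: "0 \<le> x + y * s j"
        using i(1) j(1) by (simp_all add: mult_le_0_iff)
      have "real_of_int (p $ k) \<le> real_of_int (max (q $ k) 0)" for k
      proof (cases "q $ k" "0 :: int" rule: linorder_cases)
        case less
        then have "0 \<le> x + y * s k" using j(2)[of k] y xj mult_left_mono[of "s j" "s k" y] by linarith
        then show ?thesis using less pk[of k] by (simp add: mult_nonpos_nonneg)
      next
        case equal then show ?thesis using pk[of k] by simp
      next
        case greater
        then have "x + y * s k \<le> 1" using i(2)[of k] y xi mult_left_mono[of "s k" "s i" y] by linarith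
        then have "real_of_int (q $ k) * (x + y * s k) \<le> real_of_int (q $ k) * 1"
          using greater by (intro mult_left_mono) auto
        then show ?thesis using greater pk[of k] by simp
      qed
      then have "\<forall>k. p $ k \<le> max (q $ k) 0" by (simp only: of_int_le_iff simp_thms)
      then show False using min p(1) wp by fastforce
    qed
    then show ?thesis using e by blast
  qed
qed

end

section \<open>From components to fibres\<close>

context circuit_congruence
begin

text \<open>The set of minimal points of a component is the same for \<open>u\<close>, for \<open>v\<close> and for every weight on
  the segment between them; \<open>w\<close> is the last weight on it for which \<open>e\<close> is minimal in its fibre.\<close>

lemma minimal_transfer:
  assumes R_fibre: "\<And>e e'. R e e' \<Longrightarrow> fibre_rel A e e'"
    and same: "\<And>e. minimal R u e \<longleftrightarrow> minimal R v e"
    and e: "minimal (fibre_rel A) u e"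
  shows "minimal (fibre_rel A) v e"
proof (rule ccontr)
  assume "\<not> minimal (fibre_rel A) v e"
  then obtain e0 where e0: "fibre_rel A e e0" "weight v e0 < weight v e"
    by (auto simp: minimal_def not_le)
  define D where "D = {p \<in> lattice_of A. \<forall>k. p $ k \<le> int (e $ k)}"
  have D_fibre: "\<exists>e'. fibre_rel A e e' \<and> p = zvec e - zvec e'" if "p \<in> D" for p
  proof -
    obtain e' where e': "zvec e' = zvec e - p"
      using nonneg_imp_zvec[of "zvec e - p"] \<open>p \<in> D\<close> unfolding D_def by auto
    then have "p = zvec e - zvec e'" by simp
    then show ?thesis using \<open>p \<in> D\<close> unfolding fibre_rel_def D_def by blast
  qed
  have "D \<subseteq> (\<lambda>e'. zvec e - zvec e') ` {e'. fibre_rel A e e'}" using D_fibre by blast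
  then have "finite D" using finite_fibre[OF pointed] finite_subset by blast
  have uD: "u \<bullet> rvec p \<le> 0" if "p \<in> D" for p
  proof -
    obtain e' where "fibre_rel A e e'" "p = zvec e - zvec e'" using D_fibre[OF \<open>p \<in> D\<close>] by blast
    then show ?thesis using e by (simp add: minimal_def flip: weight_diff)
  qed
  \<comment> \<open>For a difference \<open>p\<close> that improves \<open>e\<close> at \<open>v\<close>, this is the parameter at which its weight
    changes sign on the way from \<open>u\<close> to \<open>v\<close>.\<close>
  define t where "t p = - (u \<bullet> rvec p) / (v \<bullet> rvec p - u \<bullet> rvec p)" for p
  have "zvec e - zvec e0 \<in> {p \<in> D. v \<bullet> rvec p > 0}"
    using e0 weight_diff[of v e e0] by (auto simp: D_def fibre_rel_def)
  then obtain q where q: "q \<in> D" "v \<bullet> rvec q > 0"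
      "\<And>p. p \<in> D \<Longrightarrow> v \<bullet> rvec p > 0 \<Longrightarrow> t q \<le> t p"
    using ex_is_arg_min_if_finite[of "{p \<in> D. v \<bullet> rvec p > 0}" t] \<open>finite D\<close>
    unfolding is_arg_min_linorder by auto
  have t01: "0 \<le> t q" "t q < 1"
    using uD[OF q(1)] q(2) by (auto simp: t_def field_simps)
  define w where "w = (1 - t q) *\<^sub>R u + t q *\<^sub>R v"
  have w_inner: "w \<bullet> x = (1 - t q) * (u \<bullet> x) + t q * (v \<bullet> x)" for x
    by (simp add: w_def inner_add_left)
  have wq: "w \<bullet> rvec q = 0"
    using uD[OF q(1)] q(2) by (simp add: w_inner t_def field_simps)
  have wD: "w \<bullet> rvec p \<le> 0" if p: "p \<in> D" for p
  proof (cases "v \<bullet> rvec p > 0")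
    case True
    have "t q * (v \<bullet> rvec p - u \<bullet> rvec p) \<le> t p * (v \<bullet> rvec p - u \<bullet> rvec p)"
      using True uD[OF p] q(3)[OF p True] by (intro mult_right_mono) auto
    also have "\<dots> = - (u \<bullet> rvec p)" using True uD[OF p] by (simp add: t_def)
    finally show ?thesis by (simp add: w_inner algebra_simps)
  next
    case False
    then have "(1 - t q) * (u \<bullet> rvec p) \<le> 0" "t q * (v \<bullet> rvec p) \<le> 0"
      using t01 uD[OF p] by (auto simp: mult_nonneg_nonpos)
    then show ?thesis by (simp add: w_inner)
  qed
  have qL: "q \<in> lattice_of A" "q \<noteq> 0" using q by (auto simp: D_def)
  have "w \<bullet> rvec p \<le> 0" if "p \<in> lattice_of A" "\<forall>k. p $ k \<le> max (q $ k) 0" for p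
  proof (rule wD)
    have "max (q $ k) 0 \<le> int (e $ k)" for k using q(1) by (simp add: D_def)
    then show "p \<in> D" using that order_trans unfolding D_def by blast
  qed
  then obtain a a' where a: "zvec a - zvec a' = q" "R a a'"
    and a_min: "\<And>p. p \<in> lattice_of A \<Longrightarrow> \<forall>k. p $ k \<le> int (a $ k) \<Longrightarrow> w \<bullet> rvec p \<le> 0"
    using exists_minimal_join[OF qL wq] by blast
  have "finite {x. R a x}"
    by (rule finite_subset[OF _ finite_fibre[OF pointed, of a]]) (auto dest: R_fibre)
  then obtain m where m: "R a m" "\<And>x. R a x \<Longrightarrow> weight v m \<le> weight v x"
    using ex_is_arg_min_if_finite[of "{x. R a x}" "weight v"] R_refl[of a]
    unfolding is_arg_min_linorder by auto
  have "minimal R v m" unfolding minimal_def using m(2) R_trans[OF m(1)] by blast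
  then have mu: "minimal R u m" using same by blast
  have min_v: "minimal R v x" if x: "R a x" "w \<bullet> rvec (zvec a - zvec x) = 0" for x
  proof (rule ccontr)
    assume nv: "\<not> minimal R v x"
    have mx: "R m y" if "R x y" for y using m(1) x(1) R_trans[OF R_sym[OF m(1)] R_trans[OF x(1) that]] by blast
    have "weight v m < weight v x"
    proof -
      obtain y where "R x y" "weight v y < weight v x" using nv by (auto simp: minimal_def not_le)
      then show ?thesis using m(2)[OF R_trans[OF x(1)]] by fastforce
    qed
    moreover have "weight u m < weight u x"
    proof -
      have "\<not> minimal R u x" using nv same by blast
      then obtain y where "R x y" "weight u y < weight u x" by (auto simp: minimal_def not_le)
      then show ?thesis using mu mx[of y] by (fastforce simp: minimal_def)
    qed
    ultimately have "u \<bullet> rvec (zvec x - zvec m) > 0" "v \<bullet> rvec (zvec x - zvec m) > 0"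
      by (simp_all flip: weight_diff)
    then have "w \<bullet> rvec (zvec x - zvec m) > 0"
      using t01 by (simp add: w_inner add_pos_nonneg)
    moreover have "weight w x = weight w a" using x(2) weight_diff[of w a x] by simp
    ultimately have "w \<bullet> rvec (zvec a - zvec m) > 0" by (simp flip: weight_diff)
    moreover have "w \<bullet> rvec (zvec a - zvec m) \<le> 0"
      using R_fibre[OF m(1)] by (intro a_min) (simp_all add: fibre_rel_def)
    ultimately show False by simp
  qed
  have "minimal R v a" "minimal R v a'" using min_v[of a] min_v[of a'] R_refl a wq by simp_all
  then have "weight v a = weight v a'"
    using a(2) R_sym[OF a(2)] by (simp add: minimal_def order.antisym)
  then show False using q(2) weight_diff[of v a a'] a(1) by simp
qed

end

text \<open>Two exponents of one fibre differ by a translate of a lattice binomial. Conversely, the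
  coefficient sum over a fibre vanishes on the toric ideal, so no binomial across two fibres is in
  it.\<close>

lemma linked_toric_iff:
  fixes A :: "int^'n::finite^'d"
  shows "linked (toric_ideal A :: ('n, 'k::comm_ring_1) mpoly set) = fibre_rel A"
proof (intro ext iffI)
  interpret binomial_ideal "lattice_of A" "toric_ideal A :: ('n, 'k) mpoly set"
    by unfold_locales (simp add: toric_ideal_def)
  fix e e' :: "nat^'n"
  show "linked (toric_ideal A :: ('n, 'k) mpoly set) e e'" if "fibre_rel A e e'"
  proof -
    define u where "u = zvec e - zvec e'"
    define g where "g = (\<chi> i. min (e $ i) (e' $ i))"
    have "u \<in> lattice_of A" using that by (simp add: u_def fibre_rel_def)
    moreover have "e = g + pos_part u" "e' = g + neg_part u"
      by (auto simp: vec_eq_iff u_def g_def pos_part_def neg_part_def)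
    ultimately show ?thesis using linked_translate[OF linked_pos_neg, of u g] by simp
  qed
  show "fibre_rel A e e'" if l: "linked (toric_ideal A :: ('n, 'k) mpoly set) e e'"
  proof (rule ccontr)
    assume not: "\<not> fibre_rel A e e'"
    let ?S = "{x. fibre_rel A e x}"
    have "coeff_sum ?S (monomial_of e - monomial_of e' :: ('n, 'k) mpoly) = 0"
    proof (rule coeff_sum_binomial_ideal)
      show "monomial_of e - monomial_of e' \<in> (toric_ideal A :: ('n, 'k) mpoly set)"
        using l by (simp add: linked_def)
      fix u :: "int^'n" and g assume "u \<in> lattice_of A"
      then have "fibre_rel A (g + pos_part u) (g + neg_part u)"
        by (simp add: fibre_rel_def zvec_add zvec_pos_neg)
      then show "g + pos_part u \<in> ?S \<longleftrightarrow> g + neg_part u \<in> ?S"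
        by (auto intro: fibre_rel_trans[OF _ fibre_rel_sym] fibre_rel_trans)
    qed
    moreover have "fibre_rel A e e" by (simp add: fibre_rel_def lattice_0)
    ultimately show False
      using not by (simp add: monomial_of_def coeff_sum_diff coeff_sum_single)
  qed
qed

theorem initial_toric_eq_if_initial_circuit_eq:
  fixes A :: "int^'n::finite^'d::finite"
  assumes "codim2 A"
    and eq: "initial_ideal u (circuit_ideal A :: ('n, 'k::comm_ring_1) mpoly set) =
      initial_ideal v (circuit_ideal A)"
  shows "initial_ideal u (toric_ideal A :: ('n, 'k) mpoly set) = initial_ideal v (toric_ideal A)"
proof -
  let ?C = "circuit_ideal A :: ('n, 'k) mpoly set" and ?T = "toric_ideal A :: ('n, 'k) mpoly set"
  interpret codim2 A by fact
  interpret C: binomial_ideal "{c. circuit A c}" ?C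
    by unfold_locales (simp add: circuit_ideal_def)
  interpret T: binomial_ideal "lattice_of A" ?T
    by unfold_locales (simp add: toric_ideal_def)
  interpret circuit_congruence A "linked ?C"
    by (unfold_locales, rule C.linked_refl, erule C.linked_sym, erule (1) C.linked_trans,
      erule C.linked_translate, rule C.linked_pos_neg, simp)
  have "?C \<subseteq> ?T"
    unfolding circuit_ideal_def toric_ideal_def
    by (rule ideal_gen_subset) (auto simp: circuit_def intro!: ideal_gen_base)
  then have CT: "fibre_rel A e e'" if "linked ?C e e'" for e e'
    using that unfolding linked_toric_iff[where ?'k = 'k, symmetric] linked_def by blast
  have same: "minimal (linked ?C) u e \<longleftrightarrow> minimal (linked ?C) v e" for e
    using eq C.initial_ideal_eq_iff_minimal by blast
  have "minimal (linked ?T) u e \<longleftrightarrow> minimal (linked ?T) v e" for e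
    unfolding linked_toric_iff using minimal_transfer[OF CT] same by blast
  then show ?thesis using T.initial_ideal_eq_iff_minimal by blast
qed

theorem corollary5p21:
  fixes A :: "int^'n^'d"
  assumes "rank (map_matrix real_of_int A) = CARD('d)"
    and "lattice_of A \<inter> {u. \<forall>i. 0 \<le> u $ i} = {0}"
    and "int CARD('n) - int CARD('d) = 2"
  shows "fan_refines
           (groebner_fan (circuit_ideal A :: ('n, 'k::alg_closed_field) mpoly set))
           (groebner_fan (toric_ideal A :: ('n, 'k) mpoly set))"
proof -
  let ?C = "circuit_ideal A :: ('n, 'k) mpoly set" and ?T = "toric_ideal A :: ('n, 'k) mpoly set"
  have codim2: "codim2 A" using assms by unfold_locales
  have support: "\<Union> (groebner_fan I) = UNIV" for I :: "('n, 'k) mpoly set"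
  proof -
    have "u \<in> closure {v. initial_ideal u I = initial_ideal v I}" for u
      by (rule closure_subset[THEN subsetD]) simp
    then show ?thesis unfolding groebner_fan_def by blast
  qed
  have "closure {v. initial_ideal u ?C = initial_ideal v ?C}
      \<subseteq> closure {v. initial_ideal u ?T = initial_ideal v ?T}" for u
    by (rule closure_mono) (use initial_toric_eq_if_initial_circuit_eq[OF codim2] in blast)
  then show ?thesis unfolding fan_refines_def support unfolding groebner_fan_def by blast
qed

end
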